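(* Let $G=(V,E)$ be a finite or locally finite connected weighted graph with symmetric edge weights $\omega$ and vertex measure $\mu$ such that $D_\mu<\infty$, and let $p(t,x,y)$ be its heat kernel. Assume that there are positive constants $r_0,c_0,m$ such that for all $x\in V$ and all $r\geq r_0$, $$V(x,r)\leq c_0 r^m.$$ Let $C$ be a constant with $C>2D_\mu e$. Then for all large enough $t$ (that is, there exists $T>1$ such that for all $t\ge T$) and all $x\in V$, $$p(t,x,x)\geq \frac{1}{4V(x,Ct\log t)}.$$
   Context: $G=(V,E)$ is a finite or locally finite connected graph; $y\sim x$ means $\overline{xy}\in E$. Weights are given by $\omega:V\times V\to[0,\infty)$ with $\omega_{xy}=\omega_{yx}$, where $\omega_{xy}$ is the weight of the edge $\overline{xy}$. The measure is a function $\mu:V\to\mathbb{R}^+$ (positive and finite at each vertex). Put $m(x)=\sum_{y\sim x}\omega_{xy}$ (not to be confused with the constant $m$ in the claim) and $D_\mu=\sup_{x\in V} m(x)/\mu(x)$; it is assumed throughout that $D_\mu<\infty$. The $\mu$-Laplacian is $\Delta f(x)=\frac{1}{\mu(x)}\sum_{y\sim x}\omega_{xy}(f(y)-f(x))$. The natural graph metric $d(x,y)$ is the smallest number of edges of a path between $x$ and $y$; $B(x,r)=\{y\in V: d(x,y)\le r\}$ for $r\ge 0$, and $V(x,r)=\sum_{y\in B(x,r)}\mu(y)$. Heat kernel: for a finite subset $U\subset V$, let $p_U(t,x,y)$ be the (Dirichlet) heat kernel on $U$ with respect to $\mu$, i.e. $p_U(t,x,y)=\frac{1}{\mu(y)}(e^{t\Delta_U}\mathbf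 1_{\{y\}})(x)$ for $x,y\in U$, where $\Delta_U f=(\Delta f)|_U$ for functions $f$ on $U$ extended by $0$ outside $U$; and $p_U(t,x,y)=0$ if $x\notin U$ or $y\notin U$. For an exhaustion $U_1\subset U_2\subset\cdots$ of $V$ by finite subsets with $\bigcup_k U_k=V$, the heat kernel on $G$ is $p(t,x,y)=\lim_{k\to\infty}p_{U_k}(t,x,y)$; the sequence is nondecreasing in $k$ and the limit does not depend on the exhaustion. *)

theory Defs
  imports Complex_Main
begin

record 'a wgraph =
  verts :: "'a set"
  edges :: "'a set set"
  weight :: "'a \<Rightarrow> 'a \<Rightarrow> real"
  mass :: "'a \<Rightarrow> real"

definition adj :: "('a, 'b) wgraph_scheme \<Rightarrow> 'a \<Rightarrow> 'a \<Rightarrow> bool" where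
  "adj G x y \<longleftrightarrow> {x, y} \<in> edges G"

definition nbrs :: "('a, 'b) wgraph_scheme \<Rightarrow> 'a \<Rightarrow> 'a set" where
  "nbrs G x = {y. adj G x y}"

text \<open>A path is the list of the vertices it visits, so it has one edge less than its length.
  Repeated vertices are permitted; they do not affect the length of a shortest path.\<close>

definition path_between :: "('a, 'b) wgraph_scheme \<Rightarrow> 'a \<Rightarrow> 'a list \<Rightarrow> 'a \<Rightarrow> bool" where
  "path_between G x p y \<longleftrightarrow>
     p \<noteq> [] \<and> hd p = x \<and> last p = y \<and> set p \<subseteq> verts G \<and> successively (adj G) p"

text \<open>Finite graphs are locally finite, so they are included. Loops (singleton edges) are not
  excluded, and neither are edges of weight zero.\<close>

locale weighted_graph =
  fixes G :: "('a, 'b) wgraph_scheme" (structure)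
  assumes edges_subset: "edges G \<subseteq> {{x, y} | x y. x \<in> verts G \<and> y \<in> verts G}"
    and locally_finite: "x \<in> verts G \<Longrightarrow> finite (nbrs G x)"
    and connected: "\<lbrakk>x \<in> verts G; y \<in> verts G\<rbrakk> \<Longrightarrow> \<exists>p. path_between G x p y"
    and weight_nonneg: "\<lbrakk>x \<in> verts G; y \<in> verts G\<rbrakk> \<Longrightarrow> 0 \<le> weight G x y"
    and weight_sym: "\<lbrakk>x \<in> verts G; y \<in> verts G\<rbrakk> \<Longrightarrow> weight G x y = weight G y x"
    and mass_pos: "x \<in> verts G \<Longrightarrow> 0 < mass G x"

definition weighted_degree :: "('a, 'b) wgraph_scheme \<Rightarrow> 'a \<Rightarrow> real" where
  "weighted_degree G x = (\<Sum>y\<in>nbrs G x. weight G x y)"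

text \<open>The condition $D_\mu < \infty$; the real supremum below is meaningful only under it.\<close>

definition finite_D_mu :: "('a, 'b) wgraph_scheme \<Rightarrow> bool" where
  "finite_D_mu G \<longleftrightarrow> bdd_above ((\<lambda>x. weighted_degree G x / mass G x) ` verts G)"

definition D_mu :: "('a, 'b) wgraph_scheme \<Rightarrow> real" where
  "D_mu G = (SUP x\<in>verts G. weighted_degree G x / mass G x)"

definition gdist :: "('a, 'b) wgraph_scheme \<Rightarrow> 'a \<Rightarrow> 'a \<Rightarrow> nat" where
  "gdist G x y = (LEAST n. \<exists>p. path_between G x p y \<and> length p = Suc n)"

definition gball :: "('a, 'b) wgraph_scheme \<Rightarrow> 'a \<Rightarrow> real \<Rightarrow> 'a set" where
  "gball G x r = {y \<in> verts G. real (gdist G x y) \<le> r}"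

definition volume :: "('a, 'b) wgraph_scheme \<Rightarrow> 'a \<Rightarrow> real \<Rightarrow> real" where
  "volume G x r = (\<Sum>y\<in>gball G x r. mass G y)"

definition laplacian :: "('a, 'b) wgraph_scheme \<Rightarrow> ('a \<Rightarrow> real) \<Rightarrow> 'a \<Rightarrow> real" where
  "laplacian G f x = 1 / mass G x * (\<Sum>y\<in>nbrs G x. weight G x y * (f y - f x))"

text \<open>Functions on \<open>U\<close> are represented by functions on the whole type, of which only the values
  on \<open>U\<close> are used; the result is again extended by zero outside \<open>U\<close>.\<close>

definition dirichlet_laplacian ::
    "('a, 'b) wgraph_scheme \<Rightarrow> 'a set \<Rightarrow> ('a \<Rightarrow> real) \<Rightarrow> 'a \<Rightarrow> real" where
  "dirichlet_laplacian G U f x =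
     (if x \<in> U then laplacian G (\<lambda>y. if y \<in> U then f y else 0) x else 0)"

text \<open>For finite \<open>U\<close>, the exponential series of the operator \<open>t \<Delta>\<^sub>U\<close>, applied to \<open>f\<close>
  and evaluated at \<open>x\<close>. The functions on \<open>U\<close> form a finite-dimensional space, so pointwise
  convergence of the series is its convergence as a series of operators.\<close>

definition dirichlet_semigroup ::
    "('a, 'b) wgraph_scheme \<Rightarrow> 'a set \<Rightarrow> real \<Rightarrow> ('a \<Rightarrow> real) \<Rightarrow> 'a \<Rightarrow> real" where
  "dirichlet_semigroup G U t f x =
     (\<Sum>n. t ^ n / fact n * (dirichlet_laplacian G U ^^ n) f x)"

definition dirichlet_heat_kernel ::
    "('a, 'b) wgraph_scheme \<Rightarrow> 'a set \<Rightarrow> real \<Rightarrow> 'a \<Rightarrow> 'a \<Rightarrow> real" where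
  "dirichlet_heat_kernel G U t x y =
     (if x \<in> U \<and> y \<in> U
      then 1 / mass G y * dirichlet_semigroup G U t (\<lambda>z. if z = y then 1 else 0) x
      else 0)"

definition exhaustion :: "('a, 'b) wgraph_scheme \<Rightarrow> (nat \<Rightarrow> 'a set) \<Rightarrow> bool" where
  "exhaustion G U \<longleftrightarrow> (\<forall>k. finite (U k)) \<and> incseq U \<and> (\<Union>k. U k) = verts G"

text \<open>The common limit along all exhaustions. A connected locally finite graph is countable, so
  exhaustions exist.\<close>

definition heat_kernel :: "('a, 'b) wgraph_scheme \<Rightarrow> real \<Rightarrow> 'a \<Rightarrow> 'a \<Rightarrow> real" where
  "heat_kernel G t x y =
     (THE l. \<forall>U. exhaustion G U \<longrightarrow> (\<lambda>k. dirichlet_heat_kernel G (U k) t x y) \<longlonglongrightarrow> l)"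

end

theory Submission
  imports Defs "HOL-Analysis.Convex" "HOL-Analysis.Uniform_Limit"
begin

text \<open>The proof runs a random walk at Poisson times. Choose a rate \<open>D\<close> that bounds every
  \<open>m(x) / \<mu>(x)\<close>; then \<open>P = I + \<Delta> / D\<close> is a Markov operator that moves by at most one edge, and
  \<open>e\<^bsup>t\<Delta>\<^esup> = e\<^bsup>-tD\<^esup> \<Sum>\<^sub>n (tD)\<^sup>n/n! P\<^sup>n\<close>, so that \<open>p(t,x,y) \<mu>(y)\<close> is the probability that the walk
  with transition operator \<open>P\<close>, started at \<open>x\<close> and stopped after a Poisson number of steps
  of mean \<open>tD\<close>, stands at \<open>y\<close>. The formula holds for each Dirichlet kernel
  (\<open>dirichlet_semigroup_uniformization\<close>) and passes to the limit along an exhaustion because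
  \<open>P\<^sup>n\<close> is local, so each coefficient is eventually constant (\<open>heat_kernel_eq\<close>).

  Up to time \<open>t/2\<close> the number of steps has mean \<open>tD/2\<close>, and by Markov's inequality it exceeds \<open>r\<close>
  with probability at most \<open>tD/(2r)\<close>. A walk of at most \<open>r\<close> steps stays in \<open>B(x,r)\<close>, hence
  \<open>\<Sum>\<^sub>y p(t/2,x,y) \<mu>(y) \<ge> 1 - tD/(2r)\<close> over \<open>y \<in> B(x,r)\<close> (\<open>poisson_walk_gball_ge\<close>). Since \<open>P\<close> is
  reversible for \<open>\<mu>\<close>, \<open>p(t,x,x) \<ge> \<Sum>\<^sub>y p(t/2,x,y)\<^sup>2 \<mu>(y)\<close> over the same ball
  (\<open>poisson_walk_return_ge\<close>), and the Cauchy-Schwarz inequality gives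
  \<open>p(t,x,x) \<ge> (1 - tD/(2r))\<^sup>2 / V(x,r)\<close> (\<open>heat_kernel_diag_ge\<close>).

  For the theorem take \<open>D = C/(2e)\<close>, which exceeds \<open>D\<^sub>\<mu>\<close> by the choice of \<open>C\<close> and, unlike
  \<open>D\<^sub>\<mu>\<close> itself, is positive even if all weights vanish. With \<open>r = C t log t\<close> and \<open>t \<ge> e\<close> one has
  \<open>r \<ge> tD\<close>, so the numerator is at least \<open>1/4\<close>.\<close>

section \<open>Graph distance and balls\<close>

context weighted_graph
begin

lemma adj_sym: "adj G x y \<longleftrightarrow> adj G y x"
  by (simp add: adj_def insert_commute)

lemma nbrs_verts: "nbrs G x \<subseteq> verts G"
  using edges_subset by (fastforce simp: nbrs_def adj_def doubleton_eq_iff)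

lemma shortest_path:
  assumes "x \<in> verts G" "y \<in> verts G"
  shows "\<exists>p. path_between G x p y \<and> length p = Suc (gdist G x y)"
proof -
  obtain p where "path_between G x p y" using connected assms by blast
  hence "\<exists>p. path_between G x p y \<and> length p = Suc (length p - 1)"
    by (intro exI[of _ p]) (auto simp: path_between_def)
  hence "\<exists>n p. path_between G x p y \<and> length p = Suc n" by blast
  thus ?thesis unfolding gdist_def by (rule LeastI_ex)
qed

lemma gdist_le_path:
  assumes "path_between G x p y" "length p = Suc n"
  shows "gdist G x y \<le> n"
  unfolding gdist_def using assms by (intro Least_le) auto

lemma gdist_self: "x \<in> verts G \<Longrightarrow> gdist G x x = 0"
  using gdist_le_path[of x "[x]" x 0] by (simp add: path_between_def)

lemma gdist_nbr:
  assumes "x \<in> verts G" "z \<in> nbrs G x" "y \<in> verts G"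
  shows "gdist G x y \<le> Suc (gdist G z y)"
proof -
  have z: "z \<in> verts G" "adj G x z" using assms nbrs_verts by (auto simp: nbrs_def)
  obtain p where p: "path_between G z p y" "length p = Suc (gdist G z y)"
    using shortest_path z assms by blast
  have "path_between G x (x # p) y"
    using p(1) z(2) assms(1) by (cases p) (auto simp: path_between_def)
  thus ?thesis using gdist_le_path p(2) by simp
qed

lemma gdist_Suc_cases:
  assumes "x \<in> verts G" "y \<in> verts G" "gdist G x y \<le> Suc n"
  shows "y = x \<or> (\<exists>z\<in>nbrs G x. gdist G z y \<le> n)"
proof -
  obtain p where p: "path_between G x p y" "length p = Suc (gdist G x y)"
    using shortest_path assms by blast
  show ?thesis
  proof (cases "tl p")
    case Nil
    hence "p = [x]" using p(1) by (cases p) (auto simp: path_between_def)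
    thus ?thesis using p(1) by (auto simp: path_between_def)
  next
    case (Cons z q)
    hence p_eq: "p = x # z # q" using p(1) by (cases p) (auto simp: path_between_def)
    hence "path_between G z (z # q) y" "adj G x z"
      using p(1) by (auto simp: path_between_def)
    moreover have "length q \<le> n" using p(2) assms(3) p_eq by simp
    ultimately show ?thesis using gdist_le_path[of z "z # q" y "length q"]
      by (force simp: nbrs_def)
  qed
qed

text \<open>The ball of radius \<open>n + 1\<close> around \<open>x\<close> consists of \<open>x\<close> and of points in the balls of radius
  \<open>n\<close> around the finitely many neighbours of \<open>x\<close>.\<close>

lemma finite_dist_le: "x \<in> verts G \<Longrightarrow> finite {y \<in> verts G. gdist G x y \<le> n}"
proof (induction n arbitrary: x)
  case 0
  have "y = x" if y: "y \<in> verts G" "gdist G x y \<le> 0" for y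
  proof -
    obtain p where "path_between G x p y" "length p = Suc (gdist G x y)"
      using shortest_path 0 y by blast
    thus ?thesis using y(2) by (auto simp: path_between_def length_Suc_conv)
  qed
  hence "{y \<in> verts G. gdist G x y \<le> 0} \<subseteq> {x}" by blast
  thus ?case using finite_subset by blast
next
  case (Suc n)
  have "{y \<in> verts G. gdist G x y \<le> Suc n}
      \<subseteq> insert x (\<Union>z\<in>nbrs G x. {y \<in> verts G. gdist G z y \<le> n})"
    using gdist_Suc_cases Suc.prems by blast
  moreover have "finite (\<Union>z\<in>nbrs G x. {y \<in> verts G. gdist G z y \<le> n})"
    using Suc locally_finite nbrs_verts by blast
  ultimately show ?case using finite_subset by blast
qed

lemma finite_gball: "x \<in> verts G \<Longrightarrow> finite (gball G x r)"
  by (rule finite_subset[OF _ finite_dist_le[of x "nat \<lfloor>r\<rfloor>"]]) (auto simp: gball_def le_nat_floor)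

text \<open>Without an exhaustion every real number would satisfy the description that defines the heat
  kernel; its value is determined only because this one exists.\<close>

lemma exhaustion_by_balls:
  assumes "x \<in> verts G"
  shows "exhaustion G (\<lambda>k. gball G x (real k))"
  unfolding exhaustion_def
proof (intro conjI allI)
  show "finite (gball G x (real k))" for k using finite_gball assms .
  show "incseq (\<lambda>k. gball G x (real k))" by (auto simp: incseq_def gball_def)
  show "(\<Union>k. gball G x (real k)) = verts G" by (auto simp: gball_def)
qed

lemma volume_ge_mass:
  assumes "x \<in> verts G" "0 \<le> r"
  shows "mass G x \<le> volume G x r"
  unfolding volume_def
  by (rule member_le_sum[OF _ _ finite_gball])
     (use assms mass_pos gdist_self in \<open>auto simp: gball_def less_imp_le\<close>)

end

section \<open>Uniformization of the Dirichlet semigroup\<close>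

text \<open>The operator \<open>P\<^sub>U = I + \<Delta>\<^sub>U / D\<close>. Outside \<open>U\<close> it is the identity, so that
  \<open>\<Delta>\<^sub>U = D (P\<^sub>U - I)\<close> holds for all functions on the whole type.\<close>

definition lazy_step :: "('a, 'b) wgraph_scheme \<Rightarrow> real \<Rightarrow> 'a set \<Rightarrow> ('a \<Rightarrow> real) \<Rightarrow> 'a \<Rightarrow> real" where
  "lazy_step G D U f x = f x + dirichlet_laplacian G U f x / D"

lemma lazy_step_outside: "x \<notin> U \<Longrightarrow> lazy_step G D U f x = f x"
  by (simp add: lazy_step_def dirichlet_laplacian_def)

lemma lazy_step_lincomb:
  "lazy_step G D U (\<lambda>x. a * f x + b * g x) x = a * lazy_step G D U f x + b * lazy_step G D U g x"
proof -
  have "(\<Sum>y\<in>nbrs G x. weight G x y *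
          ((if y \<in> U then a * f y + b * g y else 0) - (a * f x + b * g x)))
      = a * (\<Sum>y\<in>nbrs G x. weight G x y * ((if y \<in> U then f y else 0) - f x))
      + b * (\<Sum>y\<in>nbrs G x. weight G x y * ((if y \<in> U then g y else 0) - g x))"
    unfolding sum_distrib_left sum.distrib[symmetric]
    by (intro sum.cong) (auto simp: algebra_simps)
  thus ?thesis
    by (auto simp: lazy_step_def dirichlet_laplacian_def laplacian_def algebra_simps
          add_divide_distrib)
qed

lemma funpow_lazy_step_lincomb:
  "(lazy_step G D U ^^ n) (\<lambda>x. a * f x + b * g x)
     = (\<lambda>x. a * (lazy_step G D U ^^ n) f x + b * (lazy_step G D U ^^ n) g x)"
  by (induction n) (simp_all add: lazy_step_lincomb)

lemma funpow_lazy_step_diff: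
  "(lazy_step G D U ^^ n) (\<lambda>x. a * (f x - g x))
     = (\<lambda>x. a * ((lazy_step G D U ^^ n) f x - (lazy_step G D U ^^ n) g x))"
  using funpow_lazy_step_lincomb[of n G D U a f "- a" g] by (simp add: algebra_simps)

lemma funpow_lazy_step_sum:
  assumes "finite A"
  shows "(lazy_step G D U ^^ n) (\<lambda>x. \<Sum>i\<in>A. c i * f i x)
     = (\<lambda>x. \<Sum>i\<in>A. c i * (lazy_step G D U ^^ n) (f i) x)"
  using assms
proof (induction A)
  case empty
  show ?case using funpow_lazy_step_lincomb[of n G D U 0 "\<lambda>_. 0" 0 "\<lambda>_. 0"] by simp
next
  case (insert i A)
  show ?case
    using funpow_lazy_step_lincomb[of n G D U "c i" "f i" 1 "\<lambda>x. \<Sum>i\<in>A. c i * f i x"]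
      insert by simp
qed

lemma funpow_lazy_step_Suc_left: "(lazy_step G D U ^^ Suc n) f = (lazy_step G D U ^^ n) (lazy_step G D U f)"
  by (simp add: funpow_swap1)

text \<open>Pascal's rule in the form of the induction step for the expansion of \<open>(P - I)\<^sup>n\<close>: the
  sequence \<open>a i\<close> stands for \<open>P\<^sup>i f\<close> at a point.\<close>

lemma iterated_difference_binomial:
  fixes a :: "nat \<Rightarrow> real"
  shows "(\<Sum>i\<le>n. real (n choose i) * (-1) ^ (n - i) * (a (Suc i) - a i))
       = (\<Sum>i\<le>Suc n. real (Suc n choose i) * (-1) ^ (Suc n - i) * a i)"
proof -
  have pascal: "(\<Sum>i\<le>Suc n. real (Suc n choose i) * (-1) ^ (Suc n - i) * a i)
      = (-1) ^ Suc n * a 0 + (\<Sum>i\<le>n. real (n choose i) * (-1) ^ (n - i) * a (Suc i))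
        + (\<Sum>i\<le>n. real (n choose Suc i) * (-1) ^ (n - i) * a (Suc i))"
    by (subst sum.atMost_Suc_shift) (simp add: algebra_simps sum.distrib)
  have shift: "(-1) ^ Suc n * a 0 + (\<Sum>i\<le>n. real (n choose Suc i) * (-1) ^ (n - i) * a (Suc i))
      = - (\<Sum>i\<le>Suc n. real (n choose i) * (-1) ^ (n - i) * a i)"
  proof -
    have "real (n choose Suc i) * (-1) ^ (n - i) * a (Suc i)
        = - (real (n choose Suc i) * (-1) ^ (n - Suc i) * a (Suc i))" if "i \<le> n" for i
    proof (cases "i = n")
      case True
      thus ?thesis by simp
    next
      case False
      hence "n - i = Suc (n - Suc i)" using that by simp
      thus ?thesis by simp
    qed
    hence "(\<Sum>i\<le>n. real (n choose Suc i) * (-1) ^ (n - i) * a (Suc i))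
        = - (\<Sum>i\<le>n. real (n choose Suc i) * (-1) ^ (n - Suc i) * a (Suc i))"
      unfolding sum_negf[symmetric] by (intro sum.cong refl) auto
    thus ?thesis by (subst sum.atMost_Suc_shift) simp
  qed
  have "(\<Sum>i\<le>n. real (n choose i) * (-1) ^ (n - i) * (a (Suc i) - a i))
      = (\<Sum>i\<le>n. real (n choose i) * (-1) ^ (n - i) * a (Suc i))
        - (\<Sum>i\<le>Suc n. real (n choose i) * (-1) ^ (n - i) * a i)"
    by (simp add: right_diff_distrib sum_subtractf)
  thus ?thesis using pascal shift by linarith
qed

text \<open>The binomial theorem for \<open>(D (P\<^sub>U - I))\<^sup>n\<close>, whose two summands commute.\<close>

lemma funpow_dirichlet_laplacian_binomial:
  assumes "D \<noteq> 0"
  shows "(dirichlet_laplacian G U ^^ n) f x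
    = D ^ n * (\<Sum>i\<le>n. real (n choose i) * (-1) ^ (n - i) * (lazy_step G D U ^^ i) f x)"
proof (induction n arbitrary: f)
  case 0
  show ?case by simp
next
  case (Suc n)
  have "dirichlet_laplacian G U f = (\<lambda>x. D * (lazy_step G D U f x - f x))"
    using assms by (simp add: lazy_step_def fun_eq_iff)
  hence "(dirichlet_laplacian G U ^^ Suc n) f x
      = (dirichlet_laplacian G U ^^ n) (\<lambda>x. D * (lazy_step G D U f x - f x)) x"
    by (simp only: funpow_Suc_right o_apply)
  also have "\<dots> = D ^ Suc n * (\<Sum>i\<le>n. real (n choose i) * (-1) ^ (n - i)
       * ((lazy_step G D U ^^ Suc i) f x - (lazy_step G D U ^^ i) f x))"
    unfolding Suc funpow_lazy_step_diff funpow_lazy_step_Suc_left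
    by (simp add: sum_distrib_left algebra_simps)
  finally show ?case
    using iterated_difference_binomial[of n "\<lambda>i. (lazy_step G D U ^^ i) f x"] by presburger
qed

text \<open>This is \<open>e\<^bsup>tD(P - I)\<^esup> = e\<^bsup>-tD\<^esup> e\<^bsup>tDP\<^esup>\<close>: the Cauchy product of the series of the two factors on the
  right has, by the binomial expansion, the terms of the series on the left. The bound on the
  iterates makes the second series converge absolutely.\<close>

lemma dirichlet_semigroup_uniformization:
  assumes D: "D \<noteq> 0" and bounded: "\<And>n. \<bar>(lazy_step G D U ^^ n) f x\<bar> \<le> M"
  shows "dirichlet_semigroup G U t f x
    = exp (- (t * D)) * (\<Sum>n. (t * D) ^ n / fact n * (lazy_step G D U ^^ n) f x)"
proof -
  define a where "a i = (t * D) ^ i / fact i * (lazy_step G D U ^^ i) f x" for i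
  define b where "b j = (- (t * D)) ^ j / fact j" for j
  have "summable (\<lambda>i. norm (a i))"
  proof (rule summable_comparison_test)
    have "summable (\<lambda>n. M * norm ((t * D) ^ n /\<^sub>R fact n))"
      by (intro summable_mult summable_norm_exp)
    thus "summable (\<lambda>n. M * (\<bar>t * D\<bar> ^ n / fact n))"
      by (simp add: divide_inverse power_abs abs_mult ac_simps)
    show "\<exists>N. \<forall>n\<ge>N. norm (norm (a n)) \<le> M * (\<bar>t * D\<bar> ^ n / fact n)"
    proof (intro exI allI impI)
      fix n
      have "norm (norm (a n)) = \<bar>(lazy_step G D U ^^ n) f x\<bar> * (\<bar>t * D\<bar> ^ n / fact n)"
        by (simp add: a_def abs_mult power_abs)
      also have "\<dots> \<le> M * (\<bar>t * D\<bar> ^ n / fact n)"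
        using bounded by (intro mult_right_mono) auto
      finally show "norm (norm (a n)) \<le> M * (\<bar>t * D\<bar> ^ n / fact n)" .
    qed
  qed
  moreover have "summable (\<lambda>j. norm (b j))"
    using summable_norm_exp[of "- (t * D)"] by (simp add: b_def divide_inverse mult.commute)
  ultimately have "(\<Sum>n. a n) * (\<Sum>n. b n) = (\<Sum>n. \<Sum>i\<le>n. a i * b (n - i))"
    by (rule Cauchy_product)
  moreover have "(\<Sum>i\<le>n. a i * b (n - i)) = t ^ n / fact n * (dirichlet_laplacian G U ^^ n) f x" for n
  proof -
    have "a i * b (n - i)
        = t ^ n / fact n * D ^ n * (real (n choose i) * (-1) ^ (n - i) * (lazy_step G D U ^^ i) f x)"
      if "i \<le> n" for i
    proof -
      have "(t * D) ^ i * (- (t * D)) ^ (n - i) = (-1) ^ (n - i) * (t * D) ^ n"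
        using that by (subst power_minus) (simp flip: power_add)
      hence "a i * b (n - i) = (-1) ^ (n - i) * (t * D) ^ n / (fact i * fact (n - i))
          * (lazy_step G D U ^^ i) f x"
        by (simp add: a_def b_def)
      thus ?thesis using that by (simp add: binomial_fact power_mult_distrib)
    qed
    thus ?thesis
      by (simp add: funpow_dirichlet_laplacian_binomial[OF D] sum_distrib_left mult.assoc)
  qed
  moreover have "(\<Sum>n. b n) = exp (- (t * D))"
    by (simp add: b_def exp_def divide_inverse mult.commute)
  ultimately show ?thesis
    by (simp add: dirichlet_semigroup_def a_def mult.commute)
qed

section \<open>The heat kernel as a random walk at Poisson times\<close>

text \<open>The rate is a parameter rather than \<open>D\<^sub>\<mu>\<close>, which is zero when all weights vanish, whereas one has
  to divide by the rate. The bound on the weighted degrees makes the coefficient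
  \<open>1 - m(x) / (D \<mu>(x))\<close> of \<open>f(x)\<close> in \<open>P f(x)\<close> nonnegative, so that \<open>P\<close> is monotone.\<close>

locale uniformizable_graph = weighted_graph G for G :: "('a, 'b) wgraph_scheme" (structure) +
  fixes D :: real
  assumes rate_pos: "0 < D"
    and weighted_degree_le: "x \<in> verts G \<Longrightarrow> weighted_degree G x \<le> D * mass G x"
begin

abbreviation walk :: "nat \<Rightarrow> ('a \<Rightarrow> real) \<Rightarrow> 'a \<Rightarrow> real" where
  "walk n \<equiv> lazy_step G D (verts G) ^^ n"

abbreviation walk_prob :: "nat \<Rightarrow> 'a \<Rightarrow> 'a \<Rightarrow> real" where
  "walk_prob n x y \<equiv> walk n (\<lambda>z. if z = y then 1 else 0) x"

lemma lazy_step_eq: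
  assumes "x \<in> U"
  shows "lazy_step G D U f x = (1 - weighted_degree G x / (D * mass G x)) * f x
    + (\<Sum>y\<in>nbrs G x. weight G x y * (if y \<in> U then f y else 0)) / (D * mass G x)"
proof -
  have "(\<Sum>y\<in>nbrs G x. weight G x y * ((if y \<in> U then f y else 0) - f x))
      = (\<Sum>y\<in>nbrs G x. weight G x y * (if y \<in> U then f y else 0)) - weighted_degree G x * f x"
    by (simp add: weighted_degree_def right_diff_distrib sum_subtractf sum_distrib_right)
  hence "lazy_step G D U f x = f x
      + ((\<Sum>y\<in>nbrs G x. weight G x y * (if y \<in> U then f y else 0)) - weighted_degree G x * f x)
        / (D * mass G x)"
    using assms by (simp add: lazy_step_def dirichlet_laplacian_def laplacian_def mult.commute)
  thus ?thesis by (simp add: diff_divide_distrib left_diff_distrib)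
qed

lemma lazy_step_verts_eq:
  assumes "x \<in> verts G"
  shows "lazy_step G D (verts G) f x = (1 - weighted_degree G x / (D * mass G x)) * f x
    + (\<Sum>y\<in>nbrs G x. weight G x y * f y) / (D * mass G x)"
proof -
  have "(\<Sum>y\<in>nbrs G x. weight G x y * (if y \<in> verts G then f y else 0))
      = (\<Sum>y\<in>nbrs G x. weight G x y * f y)"
    using nbrs_verts by (intro sum.cong) auto
  thus ?thesis using assms by (simp add: lazy_step_eq)
qed

lemma holding_weight_nonneg: "x \<in> verts G \<Longrightarrow> 0 \<le> 1 - weighted_degree G x / (D * mass G x)"
  using rate_pos mass_pos weighted_degree_le by (simp add: divide_le_eq_1)

lemma lazy_step_mono:
  assumes U: "U \<subseteq> verts G" and le: "\<And>y. f y \<le> g y"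
  shows "lazy_step G D U f x \<le> lazy_step G D U g x"
proof (cases "x \<in> U")
  case True
  hence x: "x \<in> verts G" using U by blast
  have "(\<Sum>y\<in>nbrs G x. weight G x y * (if y \<in> U then f y else 0))
      \<le> (\<Sum>y\<in>nbrs G x. weight G x y * (if y \<in> U then g y else 0))"
    using x le nbrs_verts[THEN subsetD] weight_nonneg by (intro sum_mono mult_left_mono) auto
  thus ?thesis
    unfolding lazy_step_eq[OF True]
    using le holding_weight_nonneg[OF x] rate_pos mass_pos[OF x]
    by (intro add_mono mult_left_mono divide_right_mono) auto
next
  case False
  thus ?thesis using le by (simp add: lazy_step_outside)
qed

lemma funpow_lazy_step_mono:
  assumes "U \<subseteq> verts G" and "\<And>y. f y \<le> g y"
  shows "(lazy_step G D U ^^ n) f x \<le> (lazy_step G D U ^^ n) g x"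
  by (induction n arbitrary: x) (use assms lazy_step_mono in auto)

lemma funpow_lazy_step_zero: "(lazy_step G D U ^^ n) (\<lambda>_. 0) = (\<lambda>_. 0)"
  using funpow_lazy_step_lincomb[of n G D U 0 "\<lambda>_. 0" 0 "\<lambda>_. 0"] by simp

lemma lazy_step_one_le:
  assumes U: "U \<subseteq> verts G"
  shows "lazy_step G D U (\<lambda>_. 1) x \<le> 1"
proof (cases "x \<in> U")
  case True
  hence x: "x \<in> verts G" using U by blast
  have "(\<Sum>y\<in>nbrs G x. weight G x y * (if y \<in> U then 1 else 0)) \<le> weighted_degree G x"
    unfolding weighted_degree_def using x nbrs_verts[THEN subsetD] weight_nonneg by (intro sum_mono) auto
  hence "(\<Sum>y\<in>nbrs G x. weight G x y * (if y \<in> U then 1 else 0)) / (D * mass G x)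
      \<le> weighted_degree G x / (D * mass G x)"
    using rate_pos mass_pos[OF x] by (intro divide_right_mono) auto
  thus ?thesis by (simp add: lazy_step_eq[OF True])
qed (simp add: lazy_step_outside)

text \<open>On the whole graph no mass is lost at a boundary, so each step preserves the
  constant 1; for the walk at Poisson times this is stochastic completeness.\<close>

lemma walk_one: "x \<in> verts G \<Longrightarrow> walk n (\<lambda>_. 1) x = 1"
proof (induction n arbitrary: x)
  case (Suc n)
  have "(\<Sum>y\<in>nbrs G x. weight G x y * walk n (\<lambda>_. 1) y) = weighted_degree G x"
    unfolding weighted_degree_def using Suc.IH nbrs_verts by (intro sum.cong) auto
  thus ?case using Suc by (simp add: lazy_step_verts_eq)
qed simp

lemma funpow_lazy_step_bounds:
  assumes U: "U \<subseteq> verts G" and f: "\<And>y. 0 \<le> f y" "\<And>y. f y \<le> 1"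
  shows "0 \<le> (lazy_step G D U ^^ n) f x" "(lazy_step G D U ^^ n) f x \<le> 1"
proof -
  show "0 \<le> (lazy_step G D U ^^ n) f x"
    using funpow_lazy_step_mono[OF U, of "\<lambda>_. 0" f n x] f by (simp add: funpow_lazy_step_zero)
  show "(lazy_step G D U ^^ n) f x \<le> 1"
  proof (induction n arbitrary: x)
    case 0
    show ?case using f by simp
  next
    case (Suc n)
    show ?case
      using lazy_step_mono[OF U, of "(lazy_step G D U ^^ n) f" "\<lambda>_. 1" x] Suc
        lazy_step_one_le[OF U, of x] by simp
  qed
qed

text \<open>The value of \<open>P\<^sub>U\<^sup>n f\<close> at \<open>x\<close> only involves vertices that are reached from \<open>x\<close> in \<open>n\<close> steps. They
  are finitely many, so an exhaustion swallows them.\<close>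

lemma eventually_funpow_lazy_step_exhaustion:
  assumes U: "exhaustion G U" and x: "x \<in> verts G"
  shows "\<forall>\<^sub>F k in sequentially. (lazy_step G D (U k) ^^ n) f x = walk n f x"
  using x
proof (induction n arbitrary: x)
  case (Suc n)
  have in_U: "\<forall>\<^sub>F k in sequentially. y \<in> U k" if y: "y \<in> verts G" for y
  proof -
    obtain k0 where "y \<in> U k0" using U y by (auto simp: exhaustion_def)
    thus ?thesis
      using U unfolding exhaustion_def eventually_sequentially incseq_def by blast
  qed
  have "\<forall>\<^sub>F k in sequentially. \<forall>y\<in>insert x (nbrs G x).
      y \<in> U k \<and> (lazy_step G D (U k) ^^ n) f y = walk n f y"
    using Suc locally_finite nbrs_verts[THEN subsetD] in_U
    by (intro eventually_ball_finite ballI eventually_conj) auto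
  thus ?case
  proof eventually_elim
    case (elim k)
    have "(\<Sum>y\<in>nbrs G x. weight G x y * (if y \<in> U k then (lazy_step G D (U k) ^^ n) f y else 0))
        = (\<Sum>y\<in>nbrs G x. weight G x y * walk n f y)"
      using elim by (intro sum.cong) auto
    thus ?case using elim Suc.prems by (simp add: lazy_step_eq[of x "U k"] lazy_step_verts_eq)
  qed
qed simp

text \<open>Termwise convergence suffices by Tannery's theorem, because sub-Markov iterates of an indicator
  lie between 0 and 1 and the series is thus dominated by the exponential series.\<close>

lemma dirichlet_heat_kernel_tendsto:
  assumes U: "exhaustion G U" and x: "x \<in> verts G" and y: "y \<in> verts G"
  shows "(\<lambda>k. dirichlet_heat_kernel G (U k) t x y) \<longlonglongrightarrow>
    1 / mass G y * (exp (- (t * D)) * (\<Sum>n. (t * D) ^ n / fact n * walk_prob n x y))"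
proof -
  define \<delta> where "\<delta> = (\<lambda>z. if z = y then 1 else 0 :: real)"
  define a where "a n k = (t * D) ^ n / fact n * (lazy_step G D (U k) ^^ n) \<delta> x" for n k
  have sub: "U k \<subseteq> verts G" for k using U by (auto simp: exhaustion_def)
  have bound: "\<bar>(lazy_step G D (U k) ^^ n) \<delta> z\<bar> \<le> 1" for k n z
    using funpow_lazy_step_bounds[OF sub, of \<delta> n k z] by (auto simp: \<delta>_def)
  have "(\<lambda>k. suminf (\<lambda>n. a n k)) \<longlonglongrightarrow> (\<Sum>n. (t * D) ^ n / fact n * walk n \<delta> x)"
  proof (rule tannerys_theorem[THEN conjunct2, THEN conjunct2])
    fix n
    have "\<forall>\<^sub>F k in sequentially. a n k = (t * D) ^ n / fact n * walk n \<delta> x"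
      using eventually_funpow_lazy_step_exhaustion[OF U x, of n \<delta>]
      by eventually_elim (simp add: a_def)
    thus "a n \<longlonglongrightarrow> (t * D) ^ n / fact n * walk n \<delta> x" by (rule tendsto_eventually)
  next
    have "norm (a n k) \<le> \<bar>t * D\<bar> ^ n / fact n" for n k
    proof -
      have "norm (a n k) = \<bar>t * D\<bar> ^ n / fact n * \<bar>(lazy_step G D (U k) ^^ n) \<delta> x\<bar>"
        by (simp add: a_def abs_mult power_abs)
      also have "\<dots> \<le> \<bar>t * D\<bar> ^ n / fact n * 1"
        using bound by (intro mult_left_mono) auto
      finally show ?thesis by simp
    qed
    thus "\<forall>\<^sub>F (n, k) in at_top \<times>\<^sub>F sequentially. norm (a n k) \<le> \<bar>t * D\<bar> ^ n / fact n"
      by (simp add: case_prod_unfold)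
    show "summable (\<lambda>n. \<bar>t * D\<bar> ^ n / fact n)"
      using summable_exp_generic[of "\<bar>t * D\<bar>"] by (simp add: divide_inverse mult.commute)
  qed simp
  hence "(\<lambda>k. 1 / mass G y * (exp (- (t * D)) * suminf (\<lambda>n. a n k)))
      \<longlonglongrightarrow> 1 / mass G y * (exp (- (t * D)) * (\<Sum>n. (t * D) ^ n / fact n * walk n \<delta> x))"
    by (intro tendsto_intros)
  moreover have "\<forall>\<^sub>F k in sequentially.
      1 / mass G y * (exp (- (t * D)) * suminf (\<lambda>n. a n k)) = dirichlet_heat_kernel G (U k) t x y"
  proof -
    obtain i j where ij: "x \<in> U i" "y \<in> U j"
      using U x y unfolding exhaustion_def by blast
    have "x \<in> U k \<and> y \<in> U k" if "k \<ge> max i j" for k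
      using U ij that unfolding exhaustion_def incseq_def by (meson max.boundedE subsetD)
    thus ?thesis unfolding eventually_sequentially
      using dirichlet_semigroup_uniformization[of D G _ \<delta> x 1 t] bound rate_pos
      by (intro exI[of _ "max i j"])
         (simp add: dirichlet_heat_kernel_def a_def flip: \<delta>_def)
  qed
  ultimately show ?thesis unfolding \<delta>_def by (rule Lim_transform_eventually)
qed

lemma heat_kernel_eq:
  assumes x: "x \<in> verts G" and y: "y \<in> verts G"
  shows "heat_kernel G t x y
    = 1 / mass G y * (exp (- (t * D)) * (\<Sum>n. (t * D) ^ n / fact n * walk_prob n x y))"
  unfolding heat_kernel_def
proof (rule the_equality)
  fix l
  assume "\<forall>U. exhaustion G U \<longrightarrow> (\<lambda>k. dirichlet_heat_kernel G (U k) t x y) \<longlonglongrightarrow> l"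
  thus "l = 1 / mass G y * (exp (- (t * D)) * (\<Sum>n. (t * D) ^ n / fact n * walk_prob n x y))"
    using exhaustion_by_balls[OF x] dirichlet_heat_kernel_tendsto[OF _ x y] LIMSEQ_unique
    by blast
qed (use dirichlet_heat_kernel_tendsto[OF _ x y] in blast)

lemma walk_prob_bounds: "0 \<le> walk_prob n x y" "walk_prob n x y \<le> 1"
  by (rule funpow_lazy_step_bounds; simp)+

section \<open>Locality and reversibility of the walk\<close>

lemma walk_local:
  assumes "x \<in> verts G" and "\<And>y. y \<in> verts G \<Longrightarrow> gdist G x y \<le> n \<Longrightarrow> f y = g y"
  shows "walk n f x = walk n g x"
  using assms
proof (induction n arbitrary: x)
  case 0
  thus ?case using gdist_self by simp
next
  case (Suc n)
  have "walk n f z = walk n g z" if z: "z \<in> nbrs G x" for z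
  proof (rule Suc.IH)
    show "z \<in> verts G" using z nbrs_verts by blast
    show "f y = g y" if "y \<in> verts G" "gdist G z y \<le> n" for y
      using that gdist_nbr[OF Suc.prems(1) z, of y] Suc.prems(2) by simp
  qed
  moreover have "walk n f x = walk n g x" using Suc by simp
  ultimately show ?case using Suc.prems(1) by (simp add: lazy_step_verts_eq cong: sum.cong)
qed

text \<open>A walk of at most \<open>r\<close> steps cannot leave the ball of radius \<open>r\<close>: by locality the indicator of
  the ball may be replaced by the constant 1, which the walk preserves.\<close>

lemma sum_walk_prob_gball:
  assumes x: "x \<in> verts G" and n: "real n \<le> r"
  shows "(\<Sum>y\<in>gball G x r. walk_prob n x y) = 1"
proof -
  have fin: "finite (gball G x r)" using finite_gball x .
  have "(\<Sum>y\<in>gball G x r. walk_prob n x y)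
      = walk n (\<lambda>z. \<Sum>y\<in>gball G x r. 1 * (if z = y then 1 else 0)) x"
    by (subst funpow_lazy_step_sum[OF fin]) simp
  also have "\<dots> = walk n (\<lambda>_. 1) x"
    using n fin by (intro walk_local[OF x]) (simp add: gball_def)
  finally show ?thesis using walk_one x by simp
qed

lemma step_kernel_eq:
  assumes x: "x \<in> verts G"
  shows "lazy_step G D (verts G) f x
    = (\<Sum>z\<in>insert x (nbrs G x). walk_prob 1 x z * f z)"
proof -
  define g where "g w = (\<Sum>z\<in>insert x (nbrs G x). f z * (if w = z then 1 else 0))" for w
  have g: "g w = f w" if "w \<in> insert x (nbrs G x)" for w
    using that locally_finite[OF x] by (simp add: g_def if_distrib[of "(*) _"] cong: if_cong)
  hence "(\<Sum>y\<in>nbrs G x. weight G x y * f y) = (\<Sum>y\<in>nbrs G x. weight G x y * g y)"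
    by (intro sum.cong) auto
  hence "lazy_step G D (verts G) f x = walk 1 g x"
    using x g by (simp add: lazy_step_verts_eq)
  also have "\<dots> = (\<Sum>z\<in>insert x (nbrs G x). f z * walk_prob 1 x z)"
    unfolding g_def by (subst funpow_lazy_step_sum) (use locally_finite[OF x] in auto)
  finally show ?thesis by (simp add: mult.commute)
qed

text \<open>The right-hand side makes the detailed balance condition visible: its first term is concentrated
  on the diagonal and its second term is symmetric.\<close>

lemma mass_walk_prob_1:
  assumes x: "x \<in> verts G"
  shows "mass G x * walk_prob 1 x z = (if z = x then mass G x - weighted_degree G x / D else 0)
    + (if z \<in> nbrs G x then weight G x z / D else 0)"
proof -
  have "(\<Sum>y\<in>nbrs G x. weight G x y * (if y = z then 1 else 0))
      = (if z \<in> nbrs G x then weight G x z else 0)"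
    using locally_finite[OF x] by (simp add: if_distrib[of "(*) _"] cong: if_cong)
  thus ?thesis using x mass_pos[OF x] rate_pos by (auto simp: lazy_step_verts_eq field_simps)
qed

lemma mass_walk_prob_1_sym:
  assumes "x \<in> verts G" "z \<in> verts G"
  shows "mass G x * walk_prob 1 x z = mass G z * walk_prob 1 z x"
  using assms adj_sym[of x z] weight_sym[of x z]
  by (cases "x = z") (simp_all add: mass_walk_prob_1 nbrs_def del: One_nat_def)

text \<open>Detailed balance for one step is iterated by splitting off the last step on one side and the
  first step on the other. The operator acts on functions rather than measures, so the last step is
  obtained by writing the one-step image of an indicator as a finite combination of indicators.\<close>

lemma walk_prob_sym:
  assumes "x \<in> verts G" "y \<in> verts G"
  shows "mass G x * walk_prob n x y = mass G y * walk_prob n y x"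
  using assms
proof (induction n arbitrary: x y)
  case (Suc n)
  define N where "N = insert y (nbrs G y)"
  have N: "finite N" "N \<subseteq> verts G"
    using Suc.prems locally_finite nbrs_verts by (auto simp: N_def)
  have one_step: "lazy_step G D (verts G) (\<lambda>z. if z = y then 1 else 0) w
      = (\<Sum>z\<in>N. walk_prob 1 z y * (if w = z then 1 else 0))" if w: "w \<in> verts G" for w
  proof -
    have "walk_prob 1 w y = 0" if "w \<notin> N"
    proof -
      have "mass G w * walk_prob 1 w y = 0"
        using that mass_walk_prob_1[OF w, of y] adj_sym[of w y] by (auto simp: N_def nbrs_def simp del: One_nat_def)
      thus ?thesis using mass_pos[OF w] by (simp only: mult_eq_0_iff) auto
    qed
    thus ?thesis using N(1) by (auto simp: if_distrib[of "(*) _"] cong: if_cong)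
  qed
  have "walk_prob (Suc n) x y
      = walk n (\<lambda>w. \<Sum>z\<in>N. walk_prob 1 z y * (if w = z then 1 else 0)) x"
    unfolding funpow_lazy_step_Suc_left by (rule walk_local[OF Suc.prems(1)]) (rule one_step)
  also have "\<dots> = (\<Sum>z\<in>N. walk_prob 1 z y * walk_prob n x z)"
    by (rule fun_cong[OF funpow_lazy_step_sum[OF N(1)]])
  finally have "mass G x * walk_prob (Suc n) x y
      = (\<Sum>z\<in>N. walk_prob 1 z y * (mass G x * walk_prob n x z))"
    by (simp add: sum_distrib_left mult.left_commute)
  also have "\<dots> = (\<Sum>z\<in>N. mass G y * (walk_prob 1 y z * walk_prob n z x))"
  proof (rule sum.cong[OF refl])
    fix z assume "z \<in> N"
    hence z: "z \<in> verts G" using N by blast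
    have "walk_prob 1 z y * (mass G x * walk_prob n x z)
        = (mass G z * walk_prob 1 z y) * walk_prob n z x"
      using Suc.IH[OF Suc.prems(1) z] by simp
    also have "\<dots> = mass G y * (walk_prob 1 y z * walk_prob n z x)"
      using mass_walk_prob_1_sym[OF z Suc.prems(2)] by (simp only: mult.assoc)
    finally show "walk_prob 1 z y * (mass G x * walk_prob n x z)
        = mass G y * (walk_prob 1 y z * walk_prob n z x)" .
  qed
  also have "\<dots> = mass G y * walk_prob (Suc n) y x"
    using step_kernel_eq[OF Suc.prems(2), of "walk n (\<lambda>z. if z = x then 1 else 0)"]
    by (simp add: N_def sum_distrib_left)
  finally show ?case .
qed auto

text \<open>Chapman--Kolmogorov, restricted to the paths that are in \<open>B\<close> at time \<open>a\<close>; reversibility turns the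
  return probability from \<open>y\<close> to \<open>x\<close> into one from \<open>x\<close> to \<open>y\<close>.\<close>

lemma walk_prob_add_ge:
  assumes x: "x \<in> verts G" and B: "finite B" "B \<subseteq> verts G"
  shows "(\<Sum>y\<in>B. mass G x / mass G y * (walk_prob a x y * walk_prob b x y)) \<le> walk_prob (a + b) x x"
proof -
  have "mass G x / mass G y * (walk_prob a x y * walk_prob b x y)
      = walk_prob b y x * walk_prob a x y" if "y \<in> B" for y
  proof -
    have y: "y \<in> verts G" using that B by blast
    have "walk_prob b y x = mass G x / mass G y * walk_prob b x y"
      using walk_prob_sym[OF x y, of b] mass_pos[OF y] by (simp add: field_simps)
    thus ?thesis by simp
  qed
  hence "(\<Sum>y\<in>B. mass G x / mass G y * (walk_prob a x y * walk_prob b x y))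
      = (\<Sum>y\<in>B. walk_prob b y x * walk_prob a x y)"
    by (intro sum.cong refl)
  also have "\<dots> = walk a (\<lambda>z. \<Sum>y\<in>B. walk_prob b y x * (if z = y then 1 else 0)) x"
    by (subst funpow_lazy_step_sum[OF B(1)]) simp
  also have "\<dots> \<le> walk a (walk b (\<lambda>z. if z = x then 1 else 0)) x"
    using B(1) walk_prob_bounds(1)
    by (intro funpow_lazy_step_mono) (auto simp: if_distrib[of "(*) _"] cong: if_cong)
  finally show ?thesis by (simp add: funpow_add)
qed

end

section \<open>Poisson times and the lower bound\<close>

text \<open>Markov's inequality for a Poisson variable of mean \<open>s\<close>, multiplied by \<open>e\<^sup>s\<close>: more than \<open>N\<close>
  occurrences have probability at most \<open>s / (N + 1)\<close>.\<close>

lemma poisson_partial_sum_ge: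
  fixes s :: real
  assumes "0 \<le> s"
  shows "exp s * (1 - s / real (Suc N)) \<le> (\<Sum>n\<le>N. s ^ n / fact n)"
proof -
  define e where "e n = s ^ n / fact n" for n
  have e: "e sums exp s"
    using exp_converges[of s] by (simp add: e_def[abs_def] divide_inverse mult.commute)
  \<comment> \<open>Summed over \<open>n\<close>, this identity computes the mean of the Poisson distribution.\<close>
  have size_bias: "real (Suc n) * e (Suc n) = s * e n" for n
  proof -
    have "s ^ Suc n / fact (Suc n) = s * s ^ n / (real (Suc n) * fact n)"
      by (simp only: power_Suc fact_Suc)
    thus ?thesis by (simp add: e_def del: of_nat_Suc)
  qed
  have "(\<lambda>n. real (Suc n) * e (Suc n)) sums (s * exp s)"
    unfolding size_bias by (rule sums_mult[OF e])
  hence mean: "(\<lambda>n. real n * e n) sums (s * exp s)"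
    by (subst (asm) sums_Suc_iff[of "\<lambda>n. real n * e n"]) simp
  have tail: "(\<lambda>n. real (Suc N) * (e n - (if n \<le> N then e n else 0)))
      sums (real (Suc N) * (exp s - (\<Sum>n\<le>N. e n)))"
    using sums_If_finite_set[of "{..N}" e] by (intro sums_mult sums_diff e) simp
  \<comment> \<open>The factor \<open>n\<close> on the right is at least \<open>N + 1\<close> wherever the left side is not zero.\<close>
  have "real (Suc N) * (e n - (if n \<le> N then e n else 0)) \<le> real n * e n" for n
    using assms by (auto simp: e_def intro!: divide_right_mono mult_right_mono)
  hence "real (Suc N) * (exp s - (\<Sum>n\<le>N. e n)) \<le> s * exp s"
    by (rule sums_le[OF _ tail mean])
  thus ?thesis by (simp add: e_def field_simps)
qed

context uniformizable_graph
begin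

lemma summable_poisson_walk:
  "summable (\<lambda>n. norm (s ^ n / fact n * walk_prob n x y))"
proof (rule summable_comparison_test)
  show "summable (\<lambda>n. \<bar>s\<bar> ^ n / fact n)"
    using summable_exp_generic[of "\<bar>s\<bar>"] by (simp add: divide_inverse mult.commute)
  show "\<exists>N. \<forall>n\<ge>N. norm (norm (s ^ n / fact n * walk_prob n x y)) \<le> \<bar>s\<bar> ^ n / fact n"
  proof (intro exI allI impI)
    fix n
    have "norm (norm (s ^ n / fact n * walk_prob n x y)) = \<bar>s\<bar> ^ n / fact n * walk_prob n x y"
      by (simp add: abs_mult power_abs abs_of_nonneg[OF walk_prob_bounds(1)])
    also have "\<dots> \<le> \<bar>s\<bar> ^ n / fact n * 1"
      using walk_prob_bounds(2) by (intro mult_left_mono) auto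
    finally show "norm (norm (s ^ n / fact n * walk_prob n x y)) \<le> \<bar>s\<bar> ^ n / fact n" by simp
  qed
qed

text \<open>After multiplication by \<open>e\<^bsup>-2s\<^esup> / \<mu>(x)\<close>, with \<open>s = tD/2\<close>, this reads
  \<open>\<Sum>\<^sub>y p(t/2,x,y)\<^sup>2 \<mu>(y) \<le> p(t,x,x)\<close> over \<open>y \<in> B\<close>. The Cauchy product of two Poisson series of mean
  \<open>s\<close> reduces it to the corresponding inequality for the numbers of steps \<open>i\<close> and \<open>n - i\<close> in the
  two halves.\<close>

lemma poisson_walk_return_ge:
  assumes x: "x \<in> verts G" and B: "finite B" "B \<subseteq> verts G" and s: "0 \<le> s"
  shows "(\<Sum>y\<in>B. mass G x / mass G y * (\<Sum>n. s ^ n / fact n * walk_prob n x y)\<^sup>2)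
      \<le> (\<Sum>n. (2 * s) ^ n / fact n * walk_prob n x x)"
proof (rule sums_le)
  let ?c = "\<lambda>y n. \<Sum>i\<le>n. s ^ i / fact i * walk_prob i x y * (s ^ (n - i) / fact (n - i) * walk_prob (n - i) x y)"
  show "(\<lambda>n. \<Sum>y\<in>B. mass G x / mass G y * ?c y n)
      sums (\<Sum>y\<in>B. mass G x / mass G y * (\<Sum>n. s ^ n / fact n * walk_prob n x y)\<^sup>2)"
    unfolding power2_eq_square
    by (intro sums_sum sums_mult Cauchy_product_sums summable_poisson_walk)
  show "(\<lambda>n. (2 * s) ^ n / fact n * walk_prob n x x)
      sums (\<Sum>n. (2 * s) ^ n / fact n * walk_prob n x x)"
    by (intro summable_sums summable_norm_cancel[OF summable_poisson_walk])
  fix n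
  have "(\<Sum>y\<in>B. mass G x / mass G y * ?c y n)
      = (\<Sum>i\<le>n. s ^ i / fact i * (s ^ (n - i) / fact (n - i)) *
          (\<Sum>y\<in>B. mass G x / mass G y * (walk_prob i x y * walk_prob (n - i) x y)))"
    unfolding sum_distrib_left
    by (subst sum.swap) (intro sum.cong refl, simp only: divide_inverse mult_ac)
  also have "\<dots> \<le> (\<Sum>i\<le>n. s ^ i / fact i * (s ^ (n - i) / fact (n - i)) * walk_prob n x x)"
  proof (intro sum_mono mult_left_mono)
    fix i assume "i \<in> {..n}"
    thus "(\<Sum>y\<in>B. mass G x / mass G y * (walk_prob i x y * walk_prob (n - i) x y))
        \<le> walk_prob n x x"
      using walk_prob_add_ge[OF x B, of i "n - i"] by simp
  qed (use s in simp)
  also have "\<dots> = (2 * s) ^ n / fact n * walk_prob n x x"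
    unfolding sum_distrib_right[symmetric] using exp_series_add_commuting[of s s n]
    by (simp add: divide_inverse mult.commute)
  finally show "(\<Sum>y\<in>B. mass G x / mass G y * ?c y n) \<le> (2 * s) ^ n / fact n * walk_prob n x x" .
qed

lemma poisson_walk_gball_ge:
  assumes x: "x \<in> verts G" and s: "0 \<le> s" and r: "0 < r"
  shows "exp s * (1 - s / r) \<le> (\<Sum>y\<in>gball G x r. \<Sum>n. s ^ n / fact n * walk_prob n x y)"
proof -
  define N where "N = nat \<lfloor>r\<rfloor>"
  have N: "real N \<le> r" "r \<le> real (Suc N)" using r by (simp_all add: N_def) linarith
  have summ: "summable (\<lambda>n. s ^ n / fact n * walk_prob n x y)" for y
    by (rule summable_norm_cancel[OF summable_poisson_walk])
  have "exp s * (1 - s / r) \<le> exp s * (1 - s / real (Suc N))"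
    using s r N(2) by (intro mult_left_mono diff_left_mono divide_left_mono) auto
  also have "\<dots> \<le> (\<Sum>n\<le>N. s ^ n / fact n)" by (rule poisson_partial_sum_ge[OF s])
  also have "\<dots> = (\<Sum>n\<le>N. s ^ n / fact n * (\<Sum>y\<in>gball G x r. walk_prob n x y))"
    using N(1) by (intro sum.cong refl) (simp add: sum_walk_prob_gball[OF x])
  also have "\<dots> = (\<Sum>n\<le>N. \<Sum>y\<in>gball G x r. s ^ n / fact n * walk_prob n x y)"
    by (simp only: sum_distrib_left)
  also have "\<dots> = (\<Sum>y\<in>gball G x r. \<Sum>n\<le>N. s ^ n / fact n * walk_prob n x y)"
    by (rule sum.swap)
  also have "\<dots> \<le> (\<Sum>y\<in>gball G x r. \<Sum>n. s ^ n / fact n * walk_prob n x y)"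
    using s walk_prob_bounds(1) by (intro sum_mono sum_le_suminf summ) auto
  finally show ?thesis .
qed

text \<open>By the Cauchy-Schwarz inequality, the probability of being in the ball at time \<open>t/2\<close> spreads over
  a set of measure \<open>V(x,r)\<close> at an \<open>L\<^sup>2\<close> cost of at least its square divided by that measure.\<close>

lemma heat_kernel_diag_ge:
  assumes x: "x \<in> verts G" and t: "0 \<le> t" and r: "t * D / 2 \<le> r" "0 < r"
  shows "(1 - t * D / (2 * r))\<^sup>2 / volume G x r \<le> heat_kernel G t x x"
proof -
  define s where "s = t * D / 2"
  define h where "h y = (\<Sum>n. s ^ n / fact n * walk_prob n x y)" for y
  have s: "0 \<le> s" using t rate_pos by (simp add: s_def)
  let ?B = "gball G x r"
  have B: "finite ?B" "?B \<subseteq> verts G" using finite_gball x by (auto simp: gball_def)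
  have mass: "0 < mass G y" if "y \<in> ?B" for y using that B mass_pos by blast
  have vol: "0 < volume G x r" using volume_ge_mass[OF x, of r] mass_pos[OF x] r by simp
  have "exp s * (1 - s / r) \<le> (\<Sum>y\<in>?B. h y)"
    unfolding h_def by (rule poisson_walk_gball_ge[OF x s r(2)])
  moreover have "0 \<le> exp s * (1 - s / r)"
    using r by (simp add: s_def)
  ultimately have "(exp s * (1 - s / r))\<^sup>2 \<le> (\<Sum>y\<in>?B. h y)\<^sup>2"
    by (intro power_mono)
  \<comment> \<open>The square roots distribute the weight \<open>\<mu>\<close> so that the second factor becomes the volume.\<close>
  also have "\<dots> = (\<Sum>y\<in>?B. (h y / sqrt (mass G y)) * sqrt (mass G y))\<^sup>2"
    using mass by (intro arg_cong[of _ _ "\<lambda>z. z\<^sup>2"] sum.cong) force+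
  also have "\<dots> \<le> (\<Sum>y\<in>?B. (h y / sqrt (mass G y))\<^sup>2) * (\<Sum>y\<in>?B. (sqrt (mass G y))\<^sup>2)"
    by (rule Cauchy_Schwarz_ineq_sum)
  also have "(\<Sum>y\<in>?B. (sqrt (mass G y))\<^sup>2) = volume G x r"
    unfolding volume_def using mass by (intro sum.cong) (auto simp: less_imp_le)
  also have "(\<Sum>y\<in>?B. (h y / sqrt (mass G y))\<^sup>2)
      = 1 / mass G x * (\<Sum>y\<in>?B. mass G x / mass G y * (h y)\<^sup>2)"
    unfolding sum_distrib_left using mass mass_pos[OF x]
    by (intro sum.cong) (auto simp: power_divide less_imp_le)
  also have "\<dots> \<le> 1 / mass G x * (\<Sum>n. (2 * s) ^ n / fact n * walk_prob n x x)"
    unfolding h_def using mass_pos[OF x]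
    by (intro mult_left_mono poisson_walk_return_ge[OF x B s]) auto
  finally have "(exp s * (1 - s / r))\<^sup>2
      \<le> 1 / mass G x * (\<Sum>n. (2 * s) ^ n / fact n * walk_prob n x x) * volume G x r"
    using vol by simp
  hence "exp (- (2 * s)) * ((exp s * (1 - s / r))\<^sup>2 / volume G x r)
      \<le> exp (- (2 * s)) * (1 / mass G x * (\<Sum>n. (2 * s) ^ n / fact n * walk_prob n x x))"
    using vol by (intro mult_left_mono) (simp_all add: pos_divide_le_eq)
  moreover have "exp (- (2 * s)) * (exp s * (1 - s / r))\<^sup>2 = (1 - s / r)\<^sup>2"
    by (simp add: power_mult_distrib exp_minus flip: exp_double)
  ultimately show ?thesis
    using heat_kernel_eq[OF x x, of t] by (simp add: s_def)
qed

end

theorem theorem3p2: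
  fixes G :: "'a wgraph" and r0 c0 m C :: real
  assumes "weighted_graph G"
    and "finite_D_mu G"
    and "r0 > 0" and "c0 > 0" and "m > 0"
    and "\<forall>x\<in>verts G. \<forall>r\<ge>r0. volume G x r \<le> c0 * r powr m"
    and "C > 2 * D_mu G * exp 1"
  shows "\<exists>T>1. \<forall>t\<ge>T. \<forall>x\<in>verts G.
           heat_kernel G t x x \<ge> 1 / (4 * volume G x (C * t * ln t))"
proof (intro exI[of _ "exp 1"] conjI allI impI ballI)
  show "exp 1 > (1::real)" by simp
next
  fix t :: real and x
  assume t: "exp 1 \<le> t" and x: "x \<in> verts G"
  interpret weighted_graph G by fact
  define D where "D = C / (2 * exp 1)"
  have degree_le_D_mu: "weighted_degree G y / mass G y \<le> D_mu G" if "y \<in> verts G" for y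
    using that assms(2) unfolding D_mu_def finite_D_mu_def by (intro cSUP_upper)
  have "0 \<le> weighted_degree G x / mass G x"
    using x mass_pos[OF x] weight_nonneg nbrs_verts[THEN subsetD] unfolding weighted_degree_def
    by (intro divide_nonneg_pos sum_nonneg) auto
  hence D_mu: "0 \<le> D_mu G" using degree_le_D_mu[OF x] by linarith
  have D_mu_less: "D_mu G < D" using assms(7) by (simp add: D_def field_simps)
  interpret uniformizable_graph G D
  proof
    show "0 < D" using D_mu D_mu_less by linarith
    show "weighted_degree G y \<le> D * mass G y" if "y \<in> verts G" for y
    proof -
      have "weighted_degree G y / mass G y \<le> D" using degree_le_D_mu[OF that] D_mu_less by simp
      thus ?thesis using mass_pos[OF that] by (simp add: pos_divide_le_eq)
    qed
  qed
  define r where "r = C * t * ln t"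
  have t_pos: "0 < t" using t exp_gt_zero[of "1::real"] by linarith
  have "ln (exp 1) \<le> ln t" using t t_pos by (subst ln_le_cancel_iff) auto
  hence ln_t: "1 \<le> ln t" by simp
  have C: "C = 2 * exp 1 * D" by (simp add: D_def)
  have "1 * 1 \<le> (2 * exp 1) * ln t"
    using ln_t exp_ge_add_one_self[of "1::real"] by (intro mult_mono) auto
  hence "t * D * 1 \<le> (t * D) * (2 * exp 1 * ln t)"
    using t_pos rate_pos by (intro mult_left_mono) auto
  hence r_ge: "t * D \<le> r" by (simp add: r_def C mult_ac)
  have tD: "0 < t * D" using t_pos rate_pos by simp
  have "(1 / 2)\<^sup>2 \<le> (1 - t * D / (2 * r))\<^sup>2"
    using r_ge tD by (intro power_mono) (simp_all add: field_simps)
  moreover have "0 < volume G x r"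
    using volume_ge_mass[OF x, of r] mass_pos[OF x] r_ge tD by simp
  ultimately have "1 / (4 * volume G x r) \<le> (1 - t * D / (2 * r))\<^sup>2 / volume G x r"
    by (simp add: field_simps power2_eq_square)
  also have "\<dots> \<le> heat_kernel G t x x"
    using heat_kernel_diag_ge[OF x, of t r] r_ge tD t_pos by simp
  finally show "heat_kernel G t x x \<ge> 1 / (4 * volume G x (C * t * ln t))"
    by (simp add: r_def)
qed

end
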